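(* Suppose $P$ is a connected link projection such that its all-$A$ dessin $\mathbb{D}=\mathbb{D}(A)$ has one vertex. For $l\ge 0$ let $a_{M-l}$ denote the coefficient of $A^{e(\mathbb{D})+2v(\mathbb{D})-2-4l}=A^{e(\mathbb{D})-4l}$ in the Kauffman bracket $\langle P\rangle$. Then $$a_{M-l}=\sum_{\mathbb{H}\subset\mathbb{D},\ 0\le g(\mathbb{H})\le l}(-1)^{e(\mathbb{H})}\binom{e(\mathbb{H})-2g(\mathbb{H})}{l-g(\mathbb{H})},$$ where the sum is over spanning sub-dessins $\mathbb{H}$ of $\mathbb{D}$. In particular, $$a_M=\sum_{\mathbb{H}\subset\mathbb{D},\ g(\mathbb{H})=0}(-1)^{e(\mathbb{H})}$$ and $$a_{M-1}=\sum_{\mathbb{H}\subset\mathbb{D},\ g(\mathbb{H})=1}(-1)^{e(\mathbb{H})}+\sum_{\mathbb{H}\subset\mathbb{D},\ g(\mathbb{H})=0}(-1)^{e(\mathbb{H})}e(\mathbb{H}).$$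
   Context: A dessin (d'enfant; combinatorial map, oriented ribbon graph) is a finite multigraph (loops and multiple edges allowed) with a cyclic order on the edge-ends at each vertex; equivalently a graph embedded in an orientable surface so that all complementary regions (faces) are disks. For a dessin $\mathbb{D}$, let $v,e,f,k$ denote the numbers of vertices, edges, faces and connected components; faces are counted as boundary components of the associated ribbon surface (an isolated vertex has one face). The genus is $g(\mathbb{D})=\frac{2k(\mathbb{D})-v(\mathbb{D})+e(\mathbb{D})-f(\mathbb{D})}{2}$. A spanning sub-dessin $\mathbb{H}\subset\mathbb{D}$ is obtained by deleting edges (keeping all vertices), with induced cyclic orders; $f(\mathbb{H}),k(\mathbb{H}),g(\mathbb{H})$ are computed for $\mathbb{H}$ as a dessin in its own right. All-$A$ dessin $\mathbb{D}(A)$ of a link diagram $P$: at each crossing the $A$-splicing is the smoothing that joins the two regions swept out when the over-strand is rotated counterclockwise onto the under-strand (the $B$-splicing is the other smoothing). Splice every crossing by its $A$-splicing to get disjoint circles in the plane, together with one arc per crossing recording the splice. Vertices of $\mathbb{D}(A)$ are the circles, edges are the crossings (arcs). Orient each circle clockwise or anti-clockwise according to whether it lies inside an odd or even number of the circles; the cyclic order at a vertex is the order in which arc-ends are met along the oriented circle. The Kauffman bracket $\langle P\rangle\in\mathbb{Z}[A,A^{-1}]$ is normalized so that the crossingless diagram of the unknot has bracket $1$: $\langle\text{crossing}\rangle=A\langle A\text{-splicing}\rangle+A^{-1}\langle B\text{-splicing}\rangle$ and an extra disjoint circle multiplies the bracket by $-A^2-A^{-2}$. Previously known expansion: $\langle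 P\rangle=\sum_{\mathbb{H}\subset\mathbb{D}}A^{e(\mathbb{D})-2e(\mathbb{H})}(-A^2-A^{-2})^{f(\mathbb{H})-1}$, summed over spanning sub-dessins. Here $a_M$ means $a_{M-0}$. *)

theory Defs
  imports Complex_Main "HOL-Library.Poly_Mapping"
begin

text \<open>The classes of \<open>V\<close> under the equivalence relation generated by \<open>r\<close>; in all uses below
  \<open>r\<close> relates elements of \<open>V\<close> only. When \<open>r\<close> is the graph of a permutation of \<open>V\<close>, these are its
  cycles.\<close>

definition class_of :: "('a \<times> 'a) set \<Rightarrow> 'a \<Rightarrow> 'a set" where
  "class_of r x = {y. (x, y) \<in> (r \<union> r\<inverse>)\<^sup>*}"

definition classes :: "'a set \<Rightarrow> ('a \<times> 'a) set \<Rightarrow> 'a set set" where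
  "classes V r = class_of r ` V"


section \<open>Dessins\<close>

text \<open>The two ends of an edge \<open>e\<close> are \<open>(e, False)\<close> and \<open>(e, True)\<close>. The function \<open>incid\<close> attaches each
  edge-end to a vertex, and \<open>rot\<close> sends an edge-end to its successor in the cyclic order at
  that vertex. Vertices without edge-ends are allowed.\<close>

record ('v, 'e) dessin =
  verts :: "'v set"
  edges :: "'e set"
  incid :: "'e \<times> bool \<Rightarrow> 'v"
  rot :: "'e \<times> bool \<Rightarrow> 'e \<times> bool"

definition ends :: "('v, 'e) dessin \<Rightarrow> ('e \<times> bool) set" where
  "ends D = edges D \<times> UNIV"

definition wf_dessin :: "('v, 'e) dessin \<Rightarrow> bool" where
  "wf_dessin D \<longleftrightarrow> finite (verts D) \<and> finite (edges D) \<and> incid D ` ends D \<subseteq> verts D \<and>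
     bij_betw (rot D) (ends D) (ends D) \<and>
     classes (ends D) {(x, rot D x) | x. x \<in> ends D} =
       {{x \<in> ends D. incid D x = w} | w. w \<in> incid D ` ends D}"

definition num_verts :: "('v, 'e) dessin \<Rightarrow> nat" where
  "num_verts D = card (verts D)"

definition num_edges :: "('v, 'e) dessin \<Rightarrow> nat" where
  "num_edges D = card (edges D)"

definition num_comps :: "('v, 'e) dessin \<Rightarrow> nat" where
  "num_comps D =
     card (classes (verts D) {(incid D (e, False), incid D (e, True)) | e. e \<in> edges D})"

fun other_end :: "'e \<times> bool \<Rightarrow> 'e \<times> bool" where
  "other_end (e, b) = (e, \<not> b)"

text \<open>Boundary components of the ribbon surface: a boundary walk runs along an edge to its other
  end and then turns to the next edge-end there; an isolated vertex is a disk with one boundary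
  circle.\<close>

definition num_faces :: "('v, 'e) dessin \<Rightarrow> nat" where
  "num_faces D =
     card (classes (ends D) {(x, rot D (other_end x)) | x. x \<in> ends D}) +
     card {w \<in> verts D. \<forall>x \<in> ends D. incid D x \<noteq> w}"

text \<open>The numerator is always even, so the integer division is exact.\<close>

definition genus :: "('v, 'e) dessin \<Rightarrow> int" where
  "genus D = (2 * int (num_comps D) - int (num_verts D) + int (num_edges D) - int (num_faces D)) div 2"

text \<open>The induced cyclic order on the remaining edge-ends is the first-return map of \<open>rot\<close>.\<close>

definition restrict_edges :: "('v, 'e) dessin \<Rightarrow> 'e set \<Rightarrow> ('v, 'e) dessin" where
  "restrict_edges D F = D\<lparr>edges := F,
     rot := (\<lambda>x. (rot D ^^ (LEAST k. 0 < k \<and> fst ((rot D ^^ k) x) \<in> F)) x)\<rparr>"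

definition sub_dessins :: "('v, 'e) dessin \<Rightarrow> ('v, 'e) dessin set" where
  "sub_dessins D = restrict_edges D ` Pow (edges D)"


section \<open>Link projections\<close>

text \<open>The crossings are \<open>0, \<dots>, n - 1\<close>. The four half-edges at crossing \<open>c\<close> are \<open>(c, 0), \<dots>, (c, 3)\<close> in
  counterclockwise order, where \<open>(c, 0)\<close> and \<open>(c, 2)\<close> form the under-strand, \<open>(c, 1)\<close> and \<open>(c, 3)\<close> the
  over-strand. The involution \<open>join\<close> pairs the two half-edges of each arc between crossings.
  The corner at \<open>c\<close> between half-edge \<open>i\<close> and half-edge \<open>i + 1\<close> (mod 4) is also denoted
  \<open>(c, i)\<close>; thus, travelling outwards from \<open>c\<close> along the half-edge \<open>(c, i)\<close>, one has the corner
  \<open>(c, i)\<close> on the left and the corner \<open>(c, i - 1)\<close> on the right. The field \<open>outer\<close> is a corner of the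
  unbounded region (irrelevant if there is no crossing), and \<open>loops\<close> counts the
  crossingless components.

  For a connected projection these data determine the diagram in the oriented plane up to isotopy.
  For a disconnected one, the relative position of the components is not recorded; this does
  not affect the bracket, but the all-\<open>A\<close> dessin below is meaningful for connected projections only.\<close>

record projection =
  crossings :: nat
  join :: "nat \<times> nat \<Rightarrow> nat \<times> nat"
  outer :: "nat \<times> nat"
  loops :: nat

definition half_edges :: "projection \<Rightarrow> (nat \<times> nat) set" where
  "half_edges P = {..<crossings P} \<times> {..<4}"

fun right_corner :: "nat \<times> nat \<Rightarrow> nat \<times> nat" where
  "right_corner (c, i) = (c, (i + 3) mod 4)"

text \<open>The regions of the 4-valent plane graph underlying \<open>P\<close>, as sets of corners: the corner to the
  left of an arc at its start lies in the same region as the corner to its left at its end.\<close>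

definition region_steps :: "projection \<Rightarrow> ((nat \<times> nat) \<times> (nat \<times> nat)) set" where
  "region_steps P = {(h, right_corner (join P h)) | h. h \<in> half_edges P}"

definition num_regions :: "projection \<Rightarrow> nat" where
  "num_regions P = card (classes (half_edges P) (region_steps P))"

text \<open>Components of the underlying 4-valent graph, crossingless components not included.\<close>

definition graph_comps :: "projection \<Rightarrow> nat" where
  "graph_comps P =
     card (classes {..<crossings P} {(fst h, fst (join P h)) | h. h \<in> half_edges P})"

text \<open>The last clause is planarity by Euler's formula: with \<open>n\<close> crossings there are \<open>2 n\<close> arcs, and
  each component of the graph has to have Euler characteristic 2.\<close>

definition link_projection :: "projection \<Rightarrow> bool" where
  "link_projection P \<longleftrightarrow>
     (\<forall>h \<in> half_edges P. join P h \<in> half_edges P \<and> join P h \<noteq> h \<and> join P (join P h) = h) \<and>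
     (0 < crossings P \<longrightarrow> outer P \<in> half_edges P) \<and>
     int (crossings P) - 2 * int (crossings P) + int (num_regions P) = 2 * int (graph_comps P)"

definition connected_projection :: "projection \<Rightarrow> bool" where
  "connected_projection P \<longleftrightarrow> graph_comps P + loops P = 1"


section \<open>Splicings and the Kauffman bracket\<close>

datatype splicing = SplA | SplB

text \<open>Rotating the over-strand, half-edges 1 and 3, counterclockwise onto the under-strand sweeps
  out the corners 1 (between 1 and 2) and 3 (between 3 and 0). The \<open>A\<close>-splicing joins these
  two regions, so it connects half-edge 0 to 1 and half-edge 2 to 3; the \<open>B\<close>-splicing connects 1 to 2
  and 3 to 0.\<close>

fun spliced_to :: "splicing \<Rightarrow> nat \<Rightarrow> nat" where
  "spliced_to SplA i = (if even i then i + 1 else i - 1)"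
| "spliced_to SplB i = (if even i then (i + 3) mod 4 else (i + 1) mod 4)"

definition splice_steps ::
    "projection \<Rightarrow> (nat \<Rightarrow> splicing) \<Rightarrow> ((nat \<times> nat) \<times> (nat \<times> nat)) set" where
  "splice_steps P s = {(h, join P h) | h. h \<in> half_edges P} \<union>
     {((c, i), (c, spliced_to (s c) i)) | c i. (c, i) \<in> half_edges P}"

definition circles :: "projection \<Rightarrow> (nat \<Rightarrow> splicing) \<Rightarrow> (nat \<times> nat) set set" where
  "circles P s = classes (half_edges P) (splice_steps P s)"

definition num_circles :: "projection \<Rightarrow> (nat \<Rightarrow> splicing) \<Rightarrow> nat" where
  "num_circles P s = card (circles P s) + loops P"

text \<open>Integral Laurent polynomials in \<open>A\<close>: finitely supported functions from exponents to
  coefficients, with the convolution product.\<close>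

type_synonym laurent = "int \<Rightarrow>\<^sub>0 int"

definition A_pow :: "int \<Rightarrow> laurent" where
  "A_pow k = Poly_Mapping.single k 1"

text \<open>In \<open>bracket_rec P cs s\<close> the crossings in \<open>cs\<close> are still unspliced and the others have been spliced
  according to \<open>s\<close>. The skein relation is applied to the crossings one after the other; \<open>m\<close>
  disjoint circles without crossings have bracket \<open>(- A ^ 2 - A ^ (-2)) ^ (m - 1)\<close>.\<close>

primrec bracket_rec :: "projection \<Rightarrow> nat list \<Rightarrow> (nat \<Rightarrow> splicing) \<Rightarrow> laurent" where
  "bracket_rec P [] s = (- A_pow 2 - A_pow (- 2)) ^ (num_circles P s - 1)"
| "bracket_rec P (c # cs) s =
     A_pow 1 * bracket_rec P cs (s(c := SplA)) + A_pow (- 1) * bracket_rec P cs (s(c := SplB))"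

text \<open>The initial splicing function is irrelevant, since every crossing gets spliced.\<close>

definition kauffman_bracket :: "projection \<Rightarrow> laurent" where
  "kauffman_bracket P = bracket_rec P [0..<crossings P] (\<lambda>_. SplA)"

lemma bracket_rec_cong:
  assumes "\<And>c. c < crossings P \<Longrightarrow> c \<notin> set cs \<Longrightarrow> s c = t c"
  shows "bracket_rec P cs s = bracket_rec P cs t"
  using assms
proof (induction cs arbitrary: s t)
  case Nil
  then have "splice_steps P s = splice_steps P t"
    unfolding splice_steps_def half_edges_def by auto
  then show ?case
    by (simp add: num_circles_def circles_def)
next
  case (Cons c cs)
  have "bracket_rec P cs (s(c := x)) = bracket_rec P cs (t(c := x))" for x
    by (rule Cons.IH) (use Cons.prems in auto)
  then show ?case by simp
qed

lemma bracket_rec_swap: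
  assumes "c \<noteq> d"
  shows "bracket_rec P (c # d # cs) s = bracket_rec P (d # c # cs) s"
  using assms by (simp add: fun_upd_twist algebra_simps)

lemma bracket_rec_move:
  assumes "c \<notin> set xs"
  shows "bracket_rec P (xs @ c # ys) s = bracket_rec P (c # xs @ ys) s"
  using assms
proof (induction xs arbitrary: s)
  case Nil
  then show ?case by simp
next
  case (Cons x xs)
  then have "bracket_rec P ((x # xs) @ c # ys) s = bracket_rec P (x # c # xs @ ys) s"
    by simp
  also have "\<dots> = bracket_rec P (c # x # xs @ ys) s"
    using Cons.prems by (intro bracket_rec_swap) auto
  finally show ?case by simp
qed

text \<open>The order of the crossings does not matter, so the skein relation holds at every crossing.\<close>

lemma bracket_rec_order:
  assumes "distinct cs" "distinct ds" "set cs = set ds"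
  shows "bracket_rec P cs s = bracket_rec P ds s"
  using assms
proof (induction cs arbitrary: ds s)
  case Nil
  then show ?case by simp
next
  case (Cons c cs)
  then obtain xs ys where ds: "ds = xs @ c # ys"
    by (metis list.set_intros(1) split_list)
  have "bracket_rec P cs t = bracket_rec P (xs @ ys) t" for t
    by (rule Cons.IH) (use Cons.prems ds in auto)
  then have "bracket_rec P (c # cs) s = bracket_rec P (c # xs @ ys) s"
    by simp
  also have "\<dots> = bracket_rec P ds s"
    using Cons.prems ds by (simp add: bracket_rec_move del: bracket_rec.simps)
  finally show ?case .
qed


section \<open>The all-\<open>A\<close> dessin\<close>

abbreviation A_circles :: "projection \<Rightarrow> (nat \<times> nat) set set" where
  "A_circles P \<equiv> circles P (\<lambda>_. SplA)"

definition A_circle_of :: "projection \<Rightarrow> nat \<times> nat \<Rightarrow> (nat \<times> nat) set" where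
  "A_circle_of P h = class_of (splice_steps P (\<lambda>_. SplA)) h"

text \<open>Moves between corners in the plane that avoid the circle \<open>\<gamma>\<close>: inside a region of \<open>P\<close>; across
  an arc of \<open>P\<close> not on \<open>\<gamma>\<close>; and through the channel opened by the \<open>A\<close>-splicing of a crossing. A
  corner is inside \<open>\<gamma>\<close> if it cannot be reached in this way from the unbounded region.\<close>

definition moves_avoiding ::
    "projection \<Rightarrow> (nat \<times> nat) set \<Rightarrow> ((nat \<times> nat) \<times> (nat \<times> nat)) set" where
  "moves_avoiding P \<gamma> = region_steps P \<union>
     {(h, right_corner h) | h. h \<in> half_edges P \<and> h \<notin> \<gamma>} \<union>
     {((c, 1), (c, 3)) | c. c < crossings P}"

definition inside :: "projection \<Rightarrow> (nat \<times> nat) set \<Rightarrow> nat \<times> nat \<Rightarrow> bool" where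
  "inside P \<gamma> x \<longleftrightarrow> x \<notin> class_of (moves_avoiding P \<gamma>) (outer P)"

text \<open>The number of circles inside which \<open>\<gamma>\<close> lies.\<close>

definition depth :: "projection \<Rightarrow> (nat \<times> nat) set \<Rightarrow> nat" where
  "depth P \<gamma> = card {\<delta> \<in> A_circles P. \<delta> \<noteq> \<gamma> \<and> (\<forall>h \<in> \<gamma>. inside P \<delta> h)}"

text \<open>Whether travelling outwards along the half-edge \<open>h\<close> agrees with the orientation of its circle:
  a circle is anti-clockwise (interior on the left) if its depth is even, and clockwise otherwise.\<close>

definition forward :: "projection \<Rightarrow> nat \<times> nat \<Rightarrow> bool" where
  "forward P h \<longleftrightarrow> (inside P (A_circle_of P h) h \<longleftrightarrow> even (depth P (A_circle_of P h)))"

text \<open>The splice arc of crossing \<open>c\<close> has the end \<open>(c, False)\<close> on the strand through the half-edges 0 and 1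
  and the end \<open>(c, True)\<close> on the strand through the half-edges 2 and 3.\<close>

fun end_at :: "nat \<times> nat \<Rightarrow> nat \<times> bool" where
  "end_at (c, i) = (c, 2 \<le> i)"

text \<open>Leaving the arc-end \<open>x\<close> along the oriented circle, one arrives at the next crossing, where the next
  arc-end sits.\<close>

definition next_end :: "projection \<Rightarrow> nat \<times> bool \<Rightarrow> nat \<times> bool" where
  "next_end P x = end_at (join P (THE h. h \<in> half_edges P \<and> end_at h = x \<and> forward P h))"

text \<open>The crossingless components of \<open>P\<close> are the vertices \<open>Inr j\<close>.\<close>

definition all_A_dessin :: "projection \<Rightarrow> ((nat \<times> nat) set + nat, nat) dessin" where
  "all_A_dessin P =
     \<lparr>verts = A_circles P <+> {..<loops P},
      edges = {..<crossings P},
      incid = (\<lambda>(c, b). Inl (A_circle_of P (c, if b then 2 else 0))),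
      rot = next_end P\<rparr>"

text \<open>The coefficient \<open>a\<^sub>M\<^sub>-\<^sub>l\<close>, where \<open>M = e + 2 v - 2\<close> for the all-\<open>A\<close> dessin.\<close>

definition bracket_coeff :: "projection \<Rightarrow> nat \<Rightarrow> int" where
  "bracket_coeff P l = Poly_Mapping.lookup (kauffman_bracket P)
     (int (num_edges (all_A_dessin P)) + 2 * int (num_verts (all_A_dessin P)) - 2 - 4 * int l)"

end

theory Submission
  imports Defs
begin

text \<open>Let \<open>n\<close> be the number of crossings. Resolving all of them writes the bracket as a sum over the sets \<open>F\<close> of \<open>B\<close>-spliced crossings:
  such a state contributes \<open>A ^ (n - 2 |F|) * (- A ^ 2 - A ^ (-2)) ^ (m - 1)\<close>, where \<open>m\<close> is its
  number of circles. The sets \<open>F\<close> are also the edge sets of the spanning sub-dessins \<open>H\<close>, and the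
  central fact is that the circles of the state are the faces of \<open>H\<close>. Since \<open>H\<close> has one vertex
  and one component, \<open>m - 1 = e(H) - 2 g(H)\<close>; the binomial theorem then places the binomial
  coefficient \<open>e(H) - 2 g(H)\<close> over \<open>j\<close> at the exponent \<open>n - 4 g(H) - 4 j\<close>, which is
  \<open>n - 4 l\<close> exactly for \<open>j = l - g(H)\<close>.

  Circles and faces are compared through permutations of the arc-ends. Let \<open>\<rho>\<close> send an arc-end
  to the next one along the oriented all-\<open>A\<close> circle. A \<open>B\<close>-splicing at a crossing makes the
  traveller who arrives at an arc-end continue from the opposite end of that arc, so the state
  circles are the cycles of \<open>\<rho>\<close> followed by the exchange of the two ends of every edge in \<open>F\<close>
  (\<open>card_circles_eq_cycles\<close>). The first-return map of this permutation to the ends of \<open>F\<close> is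
  conjugate to the face permutation of \<open>H\<close> (\<open>num_faces_restrict_edges\<close>). The first of these two
  steps needs the rotation to run coherently along the circle although orientations are defined by means of
  the inside of the circle. That is a Jordan curve statement, and Euler's formula gives it: \<open>n + 2\<close>
  regions joined by \<open>n\<close> channels leave at least two sides, a walk along the circle sees at
  most two, hence the left and the right side differ everywhere (\<open>sides_differ\<close>).

  The genus is defined by an integer division, and the exponent \<open>e(H) - 2 g(H)\<close> requires the division
  to be exact. Inserting an edge composes the permutation above with a transposition, which changes
  the number of cycles by exactly one (\<open>card_cycles_swap\<close>); starting from the single face of the
  edgeless sub-dessin, this gives both the parity and \<open>0 \<le> g(H)\<close>.\<close>


section \<open>Counting the classes of a generated equivalence\<close>

text \<open>The equality \<open>class_of r x = class_of r y\<close> serves as the notation for the generated equivalence: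
  single steps give equations by \<open>class_of_step\<close>, and an equation is exploited through a function
  that is constant along steps, by \<open>class_of_invariant\<close>.\<close>

lemma class_of_eq_iff: "class_of r x = class_of r y \<longleftrightarrow> (x, y) \<in> (r \<union> r\<inverse>)\<^sup>*"
proof
  assume "class_of r x = class_of r y"
  moreover have "y \<in> class_of r y"
    by (simp add: class_of_def)
  ultimately show "(x, y) \<in> (r \<union> r\<inverse>)\<^sup>*"
    by (auto simp: class_of_def)
next
  assume xy: "(x, y) \<in> (r \<union> r\<inverse>)\<^sup>*"
  have "sym ((r \<union> r\<inverse>)\<^sup>*)"
    by (intro sym_rtrancl) (auto simp: sym_def)
  then have "(y, x) \<in> (r \<union> r\<inverse>)\<^sup>*"
    using xy by (rule symD)
  then show "class_of r x = class_of r y"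
    using xy by (auto simp: class_of_def intro: rtrancl_trans)
qed

lemma mem_class_of_iff: "y \<in> class_of r x \<longleftrightarrow> class_of r x = class_of r y"
  by (simp add: class_of_eq_iff) (simp add: class_of_def)

lemma class_of_self: "x \<in> class_of r x"
  by (simp add: mem_class_of_iff)

lemma class_of_step: "(x, y) \<in> r \<Longrightarrow> class_of r x = class_of r y"
  by (auto simp: class_of_eq_iff)

lemma class_of_invariant:
  assumes "class_of r x = class_of r y" and inv: "\<And>u v. (u, v) \<in> r \<Longrightarrow> g u = g v"
  shows "g x = g y"
proof -
  have "(x, y) \<in> (r \<union> r\<inverse>)\<^sup>*"
    using assms(1) by (simp add: class_of_eq_iff)
  then show ?thesis
    by (induction rule: rtrancl_induct) (auto dest: inv)
qed

lemma class_of_mono: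
  assumes "class_of r x = class_of r y" "r \<subseteq> s"
  shows "class_of s x = class_of s y"
  using assms(1) by (rule class_of_invariant) (rule class_of_step, rule subsetD[OF assms(2)])

lemma class_of_subset:
  assumes "r \<subseteq> V \<times> V" "x \<in> V"
  shows "class_of r x \<subseteq> V"
proof
  fix y assume "y \<in> class_of r x"
  then have "class_of r x = class_of r y"
    by (simp add: mem_class_of_iff)
  then have "(x \<in> V) = (y \<in> V)"
    by (rule class_of_invariant) (use assms in auto)
  then show "y \<in> V"
    using assms by simp
qed

lemma Union_classes:
  assumes "r \<subseteq> V \<times> V"
  shows "\<Union> (classes V r) = V"
proof
  show "\<Union> (classes V r) \<subseteq> V"
    unfolding classes_def using class_of_subset[OF assms] by blast
  show "V \<subseteq> \<Union> (classes V r)"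
    unfolding classes_def using class_of_self by fast
qed

lemma classes_eq_singleton:
  assumes "r \<subseteq> V \<times> V" "card (classes V r) = 1"
  shows "classes V r = {V}"
proof -
  obtain C where C: "classes V r = {C}"
    using assms(2) by (auto simp: card_1_singleton_iff)
  then show ?thesis
    using Union_classes[OF assms(1)] by simp
qed

text \<open>Two kernels are compared through maps in both directions that are inverse to each other only up
  to these kernels. For \<open>F\<close> and \<open>G\<close> that form equivalence classes, this identifies two quotients
  by maps between the underlying sets.\<close>

lemma card_image_transfer:
  assumes f: "\<And>x. x \<in> V \<Longrightarrow> f x \<in> W" and g: "\<And>y. y \<in> W \<Longrightarrow> g y \<in> V"
    and F: "\<And>x x'. x \<in> V \<Longrightarrow> x' \<in> V \<Longrightarrow> F x = F x' \<Longrightarrow> G (f x) = G (f x')"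
    and G: "\<And>y y'. y \<in> W \<Longrightarrow> y' \<in> W \<Longrightarrow> G y = G y' \<Longrightarrow> F (g y) = F (g y')"
    and gf: "\<And>x. x \<in> V \<Longrightarrow> F (g (f x)) = F x"
    and fg: "\<And>y. y \<in> W \<Longrightarrow> G (f (g y)) = G y"
  shows "card (F ` V) = card (G ` W)"
proof -
  define h where "h = G \<circ> f \<circ> inv_into V F"
  have h: "h (F x) = G (f x)" if "x \<in> V" for x
  proof -
    have "inv_into V F (F x) \<in> V" "F (inv_into V F (F x)) = F x"
      using that by (simp_all add: inv_into_into f_inv_into_f)
    then show ?thesis
      unfolding h_def comp_def by (intro F that)
  qed
  have "bij_betw h (F ` V) (G ` W)"
  proof (rule bij_betw_imageI)
    have eq: "F x = F x'" if "x \<in> V" "x' \<in> V" "G (f x) = G (f x')" for x x'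
      using G[OF f[OF that(1)] f[OF that(2)] that(3)] gf[OF that(1)] gf[OF that(2)] by simp
    show "inj_on h (F ` V)"
    proof (rule inj_onI, elim imageE)
      fix c c' x x' assume "h c = h c'" "c = F x" "c' = F x'" "x \<in> V" "x' \<in> V"
      then show "c = c'"
        using eq[of x x'] by (simp add: h)
    qed
    have "G y \<in> h ` F ` V" if "y \<in> W" for y
      by (rule image_eqI[OF _ imageI[OF g[OF that]]]) (simp add: h fg g that)
    then show "h ` F ` V = G ` W"
      by (auto simp: h f)
  qed
  then show ?thesis
    by (rule bij_betw_same_card)
qed

lemma card_classes_transfer:
  assumes "\<And>x. x \<in> V \<Longrightarrow> f x \<in> W" "\<And>y. y \<in> W \<Longrightarrow> g y \<in> V"
    and "\<And>x x'. (x, x') \<in> r \<Longrightarrow> class_of s (f x) = class_of s (f x')"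
    and "\<And>y y'. (y, y') \<in> s \<Longrightarrow> class_of r (g y) = class_of r (g y')"
    and "\<And>x. x \<in> V \<Longrightarrow> class_of r (g (f x)) = class_of r x"
    and "\<And>y. y \<in> W \<Longrightarrow> class_of s (f (g y)) = class_of s y"
  shows "card (classes V r) = card (classes W s)"
  unfolding classes_def
proof (rule card_image_transfer[where f = f and g = g])
  show "class_of s (f x) = class_of s (f x')" if "class_of r x = class_of r x'" for x x'
    using that by (rule class_of_invariant) (rule assms(3))
  show "class_of r (g y) = class_of r (g y')" if "class_of s y = class_of s y'" for y y'
    using that by (rule class_of_invariant) (rule assms(4))
qed (rule assms(1,2,5,6), assumption)+

lemma card_image_same_kernel:
  assumes "\<And>x y. x \<in> V \<Longrightarrow> y \<in> V \<Longrightarrow> F x = F y \<longleftrightarrow> G x = G y"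
  shows "card (F ` V) = card (G ` V)"
  by (rule card_image_transfer[where f = id and g = id]) (simp_all add: assms)

text \<open>Adding one pair merges at most two classes. Merging the class of \<open>b\<close> into that of \<open>a\<close> is
  an explicit map on classes, and the enlarged relation has the same kernel as that map.\<close>

lemma card_classes_insert:
  assumes "finite V" "a \<in> V" "b \<in> V"
  shows "card (classes V r) =
    card (classes V (insert (a, b) r)) + (if class_of r a = class_of r b then 0 else 1)"
proof -
  let ?s = "insert (a, b) r"
  define g where "g x = class_of r (if class_of r x = class_of r b then a else x)" for x
  have ab: "class_of ?s a = class_of ?s b"
    by (rule class_of_step) simp
  have g_class: "class_of r x = class_of r y \<Longrightarrow> class_of ?s x = class_of ?s y" for x y
    by (erule class_of_mono) auto
  have "class_of ?s x = class_of ?s y \<longleftrightarrow> g x = g y" for x y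
  proof
    show "g x = g y" if "class_of ?s x = class_of ?s y"
      using that
    proof (rule class_of_invariant)
      fix u v assume "(u, v) \<in> ?s"
      then consider "u = a" "v = b" | "class_of r u = class_of r v"
        using class_of_step[of u v r] by blast
      then show "g u = g v"
        by cases (simp_all add: g_def)
    qed
    show "class_of ?s x = class_of ?s y" if "g x = g y"
    proof -
      have rep: "class_of ?s z = class_of ?s (if class_of r z = class_of r b then a else z)" for z
        using ab g_class[of z b] by simp
      show ?thesis
        unfolding rep[of x] rep[of y] by (rule g_class) (use that in \<open>simp only: g_def\<close>)
    qed
  qed
  then have card_s: "card (classes V ?s) = card (g ` V)"
    unfolding classes_def by (intro card_image_same_kernel) auto
  show ?thesis
  proof (cases "class_of r a = class_of r b")
    case True
    then have "g = class_of r"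
      by (intro ext) (simp add: g_def)
    then show ?thesis
      using True card_s by (simp add: classes_def)
  next
    case False
    have "g x \<noteq> class_of r b" for x
      using False by (simp add: g_def)
    moreover have "g x \<in> classes V r" if "x \<in> V" for x
      using that assms by (simp add: g_def classes_def)
    moreover have "class_of r x \<in> g ` V" if "x \<in> V" "class_of r x \<noteq> class_of r b" for x
      using that by (intro image_eqI[of _ _ x]) (simp_all add: g_def)
    ultimately have "g ` V = classes V r - {class_of r b}"
      unfolding classes_def by blast
    moreover have "class_of r b \<in> classes V r" "finite (classes V r)"
      using assms by (auto simp: classes_def)
    ultimately have "card (classes V r) = Suc (card (g ` V))"
      by (metis card_Suc_Diff1)
    then show ?thesis
      using False card_s by simp
  qed
qed

lemma card_classes_Un_le:
  assumes "finite V" "finite s" "s \<subseteq> V \<times> V"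
  shows "card (classes V r) \<le> card (classes V (r \<union> s)) + card s"
  using assms(2,3)
proof (induction s rule: finite_induct)
  case empty
  then show ?case by simp
next
  case (insert ab s)
  obtain a b where ab: "ab = (a, b)" "a \<in> V" "b \<in> V"
    using insert.prems by auto
  have "card (classes V (r \<union> s)) \<le> Suc (card (classes V (r \<union> insert ab s)))"
    using card_classes_insert[OF assms(1) ab(2,3), of "r \<union> s"] ab(1) by simp
  then show ?case
    using insert by simp
qed


section \<open>Cycles of a permutation after a transposition\<close>

abbreviation graph_on :: "'a set \<Rightarrow> ('a \<Rightarrow> 'a) \<Rightarrow> ('a \<times> 'a) set" where
  "graph_on V p \<equiv> {(x, p x) | x. x \<in> V}"

lemma class_of_graph_step:
  "x \<in> V \<Longrightarrow> class_of (graph_on V p) x = class_of (graph_on V p) (p x)"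
  by (rule class_of_step) blast

text \<open>In the graph of a partial function every point has at most one outgoing step, so a component
  cannot flow into two different points where the function stops: being able to reach \<open>a\<close> is
  invariant under all steps.\<close>

lemma sinks_not_linked:
  assumes "a \<noteq> b" "a \<notin> U" "b \<notin> U"
  shows "class_of (graph_on U p) a \<noteq> class_of (graph_on U p) b"
proof
  let ?r = "graph_on U p"
  assume "class_of ?r a = class_of ?r b"
  then have "((a, a) \<in> ?r\<^sup>*) = ((b, a) \<in> ?r\<^sup>*)"
  proof (rule class_of_invariant)
    fix x y assume xy: "(x, y) \<in> ?r"
    show "((x, a) \<in> ?r\<^sup>*) = ((y, a) \<in> ?r\<^sup>*)"
    proof
      assume "(x, a) \<in> ?r\<^sup>*"
      then show "(y, a) \<in> ?r\<^sup>*"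
        by (cases rule: converse_rtranclE) (use xy assms in auto)
    qed (use xy in \<open>rule converse_rtrancl_into_rtrancl\<close>)
  qed
  then have "(b, a) \<in> ?r\<^sup>*"
    by simp
  then show False
    by (cases rule: converse_rtranclE) (use assms in auto)
qed

text \<open>Cut the arrows out of \<open>a\<close> and \<open>b\<close>. Apart from closed cycles, two paths remain; they start
  at \<open>p a\<close> and \<open>p b\<close> and end at \<open>a\<close> and \<open>b\<close>, in one of the two possible pairings. Of the two ways to
  put the arrows back, one closes up each path separately and the other joins both into one cycle.\<close>

lemma card_cycles_swap:
  assumes fin: "finite V" and inj: "inj_on p V" and maps: "p ` V \<subseteq> V"
    and ab: "a \<in> V" "b \<in> V" "a \<noteq> b"
    and p': "p' a = p b" "p' b = p a" "\<And>x. x \<in> V \<Longrightarrow> x \<noteq> a \<Longrightarrow> x \<noteq> b \<Longrightarrow> p' x = p x"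
  shows "card (classes V (graph_on V p)) = Suc (card (classes V (graph_on V p'))) \<or>
         card (classes V (graph_on V p')) = Suc (card (classes V (graph_on V p)))"
proof -
  let ?r = "graph_on (V - {a, b}) p"
  let ?K = "class_of ?r"
  have r: "graph_on V p = insert (a, p a) (insert (b, p b) ?r)"
    using ab by auto
  have r': "graph_on V p' = insert (a, p b) (insert (b, p a) ?r)"
    using ab p' by auto
  have inV: "p a \<in> V" "p b \<in> V"
    using ab maps by auto
  have K_ab: "?K a \<noteq> ?K b"
    using ab by (intro sinks_not_linked) auto
  have sub: "?r \<subseteq> V \<times> V"
    using maps by auto
  \<comment> \<open>a component closed under \<open>p\<close> is mapped onto itself, because it is finite and \<open>p\<close> is
    injective; hence no arrow enters it from outside\<close>
  have closed: "x \<in> C" if "C = ?K y" "y \<in> V" "x \<in> V" "p x \<in> C"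
      "a \<in> C \<Longrightarrow> p a \<in> C" "b \<in> C \<Longrightarrow> p b \<in> C" for C x y
  proof -
    have C: "C \<subseteq> V"
      using that(1,2) class_of_subset[OF sub] by simp
    have "p z \<in> C" if "z \<in> C" for z
    proof (cases "z = a \<or> z = b")
      case False
      then have "?K z = ?K (p z)"
        using that C by (intro class_of_step) auto
      then show ?thesis
        using that \<open>C = ?K y\<close> by (simp add: mem_class_of_iff)
    qed (use that \<open>a \<in> C \<Longrightarrow> p a \<in> C\<close> \<open>b \<in> C \<Longrightarrow> p b \<in> C\<close> in auto)
    then have "p ` C = C"
      using C fin inj by (intro endo_inj_surj) (auto intro: finite_subset inj_on_subset)
    then obtain z where "z \<in> C" "p z = p x"
      using \<open>p x \<in> C\<close> by (metis imageE)
    then show "x \<in> C"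
      using inj C \<open>x \<in> V\<close> by (metis inj_onD subsetD)
  qed
  have end_pa: "?K (p a) = ?K a \<or> ?K (p a) = ?K b"
    unfolding mem_class_of_iff[symmetric]
    using closed[OF refl inV(1) ab(1) class_of_self] class_of_self by blast
  have end_pb: "?K (p b) = ?K a \<or> ?K (p b) = ?K b"
    unfolding mem_class_of_iff[symmetric]
    using closed[OF refl inV(2) ab(2) class_of_self] class_of_self by blast
  have "?K (p a) \<noteq> ?K (p b)"
  proof
    assume eq: "?K (p a) = ?K (p b)"
    then have "p a \<in> ?K (p a)" "p b \<in> ?K (p a)"
      by (simp_all add: mem_class_of_iff)
    then have "a \<in> ?K (p a)" "b \<in> ?K (p a)"
      using closed[OF refl inV(1) ab(1)] closed[OF refl inV(1) ab(2)] by blast+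
    then show False
      using K_ab unfolding mem_class_of_iff by simp
  qed
  then have cases: "?K (p a) = ?K a \<and> ?K (p b) = ?K b \<or> ?K (p a) = ?K b \<and> ?K (p b) = ?K a"
    using end_pa end_pb by (elim disjE) simp_all
  let ?s = "insert (b, p b) ?r" and ?s' = "insert (b, p a) ?r"
  have up: "?K x = ?K y \<Longrightarrow> class_of (insert e ?r) x = class_of (insert e ?r) y" for x y e
    by (erule class_of_mono) auto
  have s: "class_of ?s b = class_of ?s (p b)" and s': "class_of ?s' b = class_of ?s' (p a)"
    by (rule class_of_step, simp)+
  have "class_of ?s a = class_of ?s (p a)" "class_of ?s' a = class_of ?s' (p b)"
    using cases
  proof (atomize (full), elim disjE conjE)
    assume *: "?K (p a) = ?K a" "?K (p b) = ?K b"
    show "class_of ?s a = class_of ?s (p a) \<and> class_of ?s' a = class_of ?s' (p b)"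
      using up[OF *(1)] up[OF *(2)] s' by simp
  next
    assume *: "?K (p a) = ?K b" "?K (p b) = ?K a"
    show "class_of ?s a = class_of ?s (p a) \<and> class_of ?s' a = class_of ?s' (p b)"
      using up[OF *(1)] up[OF *(2)] s by simp
  qed
  then have "card (classes V (graph_on V p)) = card (classes V ?s)"
      "card (classes V (graph_on V p')) = card (classes V ?s')"
    using card_classes_insert[OF fin ab(1) inV(1), of ?s]
      card_classes_insert[OF fin ab(1) inV(2), of ?s'] by (simp_all add: r r')
  moreover have "card (classes V ?r) = card (classes V ?s) + (if ?K b = ?K (p b) then 0 else 1)"
      "card (classes V ?r) = card (classes V ?s') + (if ?K b = ?K (p a) then 0 else 1)"
    using card_classes_insert[OF fin ab(2) inV(2)] card_classes_insert[OF fin ab(2) inV(1)] by blast+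
  ultimately show ?thesis
    using cases K_ab K_ab[symmetric] by (elim disjE conjE) simp_all
qed


section \<open>Faces and genus of the sub-dessins of a one-vertex dessin\<close>

text \<open>Exchanging the ends of the edges in \<open>F\<close> after the rotation is the combinatorial form of making
  \<open>B\<close>-splicings at the crossings in \<open>F\<close>.\<close>

definition flip_in :: "'e set \<Rightarrow> 'e \<times> bool \<Rightarrow> 'e \<times> bool" where
  "flip_in F x = (if fst x \<in> F then other_end x else x)"

lemma fst_other_end [simp]: "fst (other_end x) = fst x"
  by (cases x) simp

lemma other_end_other_end [simp]: "other_end (other_end x) = x"
  by (cases x) simp

lemma fst_flip_in [simp]: "fst (flip_in F x) = fst x"
  by (simp add: flip_in_def)

lemma flip_in_flip_in [simp]: "flip_in F (flip_in F x) = x"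
  by (simp add: flip_in_def)

lemma mem_ends [simp]: "x \<in> ends D \<longleftrightarrow> fst x \<in> edges D"
  by (cases x) (simp add: ends_def)

lemma edges_restrict_edges [simp]: "edges (restrict_edges D F) = F"
  and verts_restrict_edges [simp]: "verts (restrict_edges D F) = verts D"
  and incid_restrict_edges [simp]: "incid (restrict_edges D F) = incid D"
  by (simp_all add: restrict_edges_def)

lemma rot_restrict_edges:
  "rot (restrict_edges D F) x = (rot D ^^ (LEAST k. 0 < k \<and> fst ((rot D ^^ k) x) \<in> F)) x"
  by (simp add: restrict_edges_def)

lemma rot_restrict_edges_hit:
  assumes "fst (rot D x) \<in> F"
  shows "rot (restrict_edges D F) x = rot D x"
proof -
  have "(LEAST k. 0 < k \<and> fst ((rot D ^^ k) x) \<in> F) = 1"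
    using assms by (intro Least_equality) auto
  then show ?thesis
    by (simp add: rot_restrict_edges)
qed

lemma rot_restrict_edges_miss:
  assumes "fst (rot D x) \<notin> F" and k: "0 < k" "fst ((rot D ^^ k) x) \<in> F"
  shows "rot (restrict_edges D F) x = rot (restrict_edges D F) (rot D x)"
proof -
  have "(LEAST k. 0 < k \<and> fst ((rot D ^^ k) x) \<in> F) =
      Suc (LEAST m. 0 < Suc m \<and> fst ((rot D ^^ Suc m) x) \<in> F)"
    by (rule Least_Suc[of _ k]) (use k in auto)
  also have "(LEAST m. 0 < Suc m \<and> fst ((rot D ^^ Suc m) x) \<in> F) =
      (LEAST m. 0 < m \<and> fst ((rot D ^^ m) (rot D x)) \<in> F)"
  proof (rule arg_cong[of _ _ Least], rule ext)
    fix m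
    show "(0 < Suc m \<and> fst ((rot D ^^ Suc m) x) \<in> F) =
        (0 < m \<and> fst ((rot D ^^ m) (rot D x)) \<in> F)"
      using assms(1) by (cases m) (simp_all add: funpow_swap1)
  qed
  finally show ?thesis
    by (simp add: rot_restrict_edges funpow_swap1)
qed

locale one_vertex_dessin =
  fixes D :: "('v, 'e) dessin"
  assumes wf: "wf_dessin D" and one_vert: "num_verts D = 1"
begin

lemma finite_edges: "finite (edges D)" and finite_ends: "finite (ends D)"
  using wf by (auto simp: wf_dessin_def ends_def)

lemma rot_bij: "bij_betw (rot D) (ends D) (ends D)"
  using wf by (simp add: wf_dessin_def)

lemma rot_in_ends: "fst x \<in> edges D \<Longrightarrow> fst (rot D x) \<in> edges D"
  using bij_betwE[OF rot_bij] by simp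

lemma obtain_vertex:
  obtains v where "verts D = {v}" "\<And>x. fst x \<in> edges D \<Longrightarrow> incid D x = v"
proof -
  obtain v where v: "verts D = {v}"
    using one_vert by (auto simp: num_verts_def card_1_singleton_iff)
  moreover have "incid D x = v" if "fst x \<in> edges D" for x
  proof -
    have "x \<in> ends D" "incid D ` ends D \<subseteq> {v}"
      using that wf v by (simp_all add: wf_dessin_def)
    then show ?thesis
      by blast
  qed
  ultimately show ?thesis
    using that by blast
qed

lemma rot_single_cycle:
  assumes "edges D \<noteq> {}"
  shows "classes (ends D) (graph_on (ends D) (rot D)) = {ends D}"
proof -
  obtain v where "\<And>x. fst x \<in> edges D \<Longrightarrow> incid D x = v"
    using obtain_vertex by blast
  then have v: "incid D x = v" if "x \<in> ends D" for x
    using that by simp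
  have "ends D \<noteq> {}"
    using assms by (auto simp: ends_def)
  then have "incid D ` ends D = {v}"
    using v by auto
  moreover have "{x \<in> ends D. incid D x = v} = ends D"
    using v by blast
  moreover have "classes (ends D) (graph_on (ends D) (rot D)) =
      {{x \<in> ends D. incid D x = w} | w. w \<in> incid D ` ends D}"
    using wf unfolding wf_dessin_def by (elim conjE)
  ultimately show ?thesis
    by (simp only: setcompr_eq_image Collect_mem_eq image_insert image_empty)
qed

text \<open>The forward orbit of \<open>x\<close> is mapped into itself by an injection and is finite, so it is also
  closed backwards; the rotation being a single cycle, the orbit contains all ends.\<close>

lemma rot_returns:
  assumes x: "fst x \<in> edges D" and F: "F \<subseteq> edges D" "F \<noteq> {}"
  shows "\<exists>k>0. fst ((rot D ^^ k) x) \<in> F"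
proof -
  let ?r = "graph_on (ends D) (rot D)"
  define T where "T = {(rot D ^^ k) x | k. 0 < k}"
  have rot_T: "rot D y \<in> T" if "y = x \<or> y \<in> T" for y
  proof -
    have "\<exists>k. y = (rot D ^^ k) x"
      using that by (auto simp: T_def intro: exI[of _ 0])
    then obtain k where "y = (rot D ^^ k) x" ..
    then have "rot D y = (rot D ^^ Suc k) x"
      by simp
    then show ?thesis
      unfolding T_def by blast
  qed
  have "(rot D ^^ k) x \<in> ends D" for k
    by (induction k) (simp_all add: x rot_in_ends)
  then have T: "T \<subseteq> ends D"
    unfolding T_def by blast
  have inj: "inj_on (rot D) (ends D)"
    using rot_bij by (rule bij_betw_imp_inj_on)
  have surj: "rot D ` T = T"
    using finite_subset[OF T finite_ends] inj_on_subset[OF inj T] rot_T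
    by (intro endo_inj_surj) blast+
  have invariant: "(y \<in> T) = (rot D y \<in> T)" if "y \<in> ends D" for y
  proof
    assume "rot D y \<in> T"
    then obtain t where t: "t \<in> T" "rot D t = rot D y"
      using surj by (metis (no_types, lifting) imageE)
    then have "t = y"
      using that T by (intro inj_onD[OF inj t(2)]) (rule subsetD)
    then show "y \<in> T"
      using t by simp
  qed (rule rot_T, rule disjI2)
  have x_in: "x \<in> ends D"
    using x by simp
  have "rot D x \<in> T"
    using rot_T by simp
  then have xT: "x \<in> T"
    using invariant[OF x_in] by simp
  obtain e where e: "e \<in> F"
    using F by auto
  have "class_of ?r x \<in> classes (ends D) ?r"
    using x_in by (simp add: classes_def)
  then have "class_of ?r x = ends D"
    using rot_single_cycle x by blast
  moreover have "(e, False) \<in> ends D"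
    using F e by auto
  ultimately have "(e, False) \<in> class_of ?r x"
    by simp
  then have "class_of ?r x = class_of ?r (e, False)"
    by (simp only: mem_class_of_iff)
  then have "(x \<in> T) = ((e, False) \<in> T)"
  proof (rule class_of_invariant)
    show "(y \<in> T) = (z \<in> T)" if "(y, z) \<in> ?r" for y z
      using that invariant[of y] by blast
  qed
  then have "(e, False) \<in> T"
    using xT by simp
  then obtain k where k: "0 < k" "(rot D ^^ k) x = (e, False)"
    by (auto simp: T_def)
  then show ?thesis
    using e by (intro exI[of _ k]) simp
qed

lemma rot_restrict_edges_in:
  assumes "fst x \<in> edges D" "F \<subseteq> edges D" "F \<noteq> {}"
  shows "fst (rot (restrict_edges D F) x) \<in> F"
  using LeastI_ex[OF rot_returns[OF assms]] by (simp add: rot_restrict_edges)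

text \<open>Outside \<open>F\<close> the flipped rotation agrees with the rotation, so it follows the original cyclic
  order up to the first return to \<open>F\<close> and only there passes to the other end.\<close>

lemma linked_to_return:
  assumes "fst x \<in> edges D" "F \<subseteq> edges D" "F \<noteq> {}"
  shows "class_of (graph_on (ends D) (\<lambda>x. flip_in F (rot D x))) x =
    class_of (graph_on (ends D) (\<lambda>x. flip_in F (rot D x))) (other_end (rot (restrict_edges D F) x))"
proof -
  let ?K = "class_of (graph_on (ends D) (\<lambda>x. flip_in F (rot D x)))"
  obtain k where "0 < k" "fst ((rot D ^^ k) x) \<in> F"
    using rot_returns[OF assms] by blast
  then show ?thesis
    using assms(1)
  proof (induction k arbitrary: x)
    case (Suc k)
    have step: "?K x = ?K (flip_in F (rot D x))"
      using Suc.prems by (intro class_of_graph_step) simp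
    show ?case
    proof (cases "fst (rot D x) \<in> F")
      case True
      then show ?thesis
        using step by (simp add: rot_restrict_edges_hit flip_in_def)
    next
      case False
      have "0 < k" "fst ((rot D ^^ k) (rot D x)) \<in> F"
        using Suc.prems(2) False by (cases k; simp add: funpow_swap1)+
      then have "?K (rot D x) = ?K (other_end (rot (restrict_edges D F) (rot D x)))"
        using Suc.prems(3) by (intro Suc.IH rot_in_ends)
      then show ?thesis
        using step False rot_restrict_edges_miss[OF False Suc.prems(1,2)] by (simp add: flip_in_def)
    qed
  qed simp
qed

text \<open>By \<open>linked_to_return\<close>, the first-return map of the flipped rotation to the ends of \<open>F\<close> is the
  induced rotation followed by \<open>other_end\<close>, whereas a face step is \<open>other_end\<close> followed by the
  induced rotation. So \<open>other_end\<close> carries faces to cycles. No cycle avoids \<open>F\<close> when \<open>F\<close> is nonempty; for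
  empty \<open>F\<close> the one cycle of the rotation matches the boundary of the isolated vertex.\<close>

lemma num_faces_restrict_edges:
  assumes F: "F \<subseteq> edges D" and ne: "edges D \<noteq> {}"
  shows "num_faces (restrict_edges D F) =
    card (classes (ends D) (graph_on (ends D) (\<lambda>x. flip_in F (rot D x))))"
proof (cases "F = {}")
  case True
  then show ?thesis
    using rot_single_cycle[OF ne] one_vert
    by (simp add: num_faces_def ends_def num_verts_def classes_def flip_in_def)
next
  case False
  let ?D = "restrict_edges D F"
  let ?faces = "graph_on (ends ?D) (\<lambda>x. rot ?D (other_end x))"
  let ?cycles = "graph_on (ends D) (\<lambda>x. flip_in F (rot D x))"
  obtain v where v: "verts D = {v}" "\<And>x. fst x \<in> edges D \<Longrightarrow> incid D x = v"
    using obtain_vertex by blast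
  obtain e where "e \<in> F"
    using False by auto
  then have no_isolated: "{w \<in> verts ?D. \<forall>x \<in> ends ?D. incid ?D x \<noteq> w} = {}"
    using v F by (auto intro!: bexI[of _ "(e, False)"])
  have face: "class_of ?faces x = class_of ?faces (rot ?D (other_end x))" if "fst x \<in> F" for x
    using that by (intro class_of_graph_step) simp
  have "card (classes (ends ?D) ?faces) = card (classes (ends D) ?cycles)"
  proof (rule card_classes_transfer[where f = other_end and g = "rot ?D"])
    show "other_end x \<in> ends D" if "x \<in> ends ?D" for x
      using that F by auto
    show "rot ?D y \<in> ends ?D" if "y \<in> ends D" for y
      using that rot_restrict_edges_in[OF _ F False] by simp
    show "class_of ?cycles (other_end x) = class_of ?cycles (other_end x')"
      if "(x, x') \<in> ?faces" for x x'
    proof -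
      have "fst (other_end x) \<in> edges D" "x' = rot ?D (other_end x)"
        using that F by auto
      then show ?thesis
        using linked_to_return[OF _ F False, of "other_end x"] by simp
    qed
    show "class_of ?faces (rot ?D y) = class_of ?faces (rot ?D y')"
      if "(y, y') \<in> ?cycles" for y y'
    proof -
      have y: "fst y \<in> edges D" and y': "y' = flip_in F (rot D y)"
        using that by auto
      show ?thesis
      proof (cases "fst (rot D y) \<in> F")
        case True
        then show ?thesis
          using face[of "rot D y"] y' by (simp add: rot_restrict_edges_hit flip_in_def)
      next
        case False
        then obtain k where "0 < k" "fst ((rot D ^^ k) y) \<in> F"
          using rot_returns[OF y F] \<open>F \<noteq> {}\<close> by blast
        then show ?thesis
          using y' False by (simp add: rot_restrict_edges_miss flip_in_def)
      qed
    qed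
    show "class_of ?faces (rot ?D (other_end x)) = class_of ?faces x" if "x \<in> ends ?D" for x
      using face[of x] that by simp
    show "class_of ?cycles (other_end (rot ?D y)) = class_of ?cycles y" if "y \<in> ends D" for y
      using linked_to_return[OF _ F False, of y] that by simp
  qed
  then show ?thesis
    unfolding num_faces_def no_isolated by (simp only: card.empty add_0_right)
qed

lemma num_faces_pos:
  assumes "F \<subseteq> edges D"
  shows "0 < num_faces (restrict_edges D F)"
proof (cases "F = {}")
  case True
  then show ?thesis
    using one_vert by (simp add: num_faces_def ends_def num_verts_def classes_def)
next
  case False
  have "finite F"
    using assms finite_edges by (rule finite_subset)
  then have "finite (classes (ends (restrict_edges D F)) r)" "classes (ends (restrict_edges D F)) r \<noteq> {}" for r
    using False by (simp_all add: classes_def ends_def)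
  then show ?thesis
    by (simp add: num_faces_def card_gt_0_iff)
qed

text \<open>Inserting \<open>e\<close> into \<open>F\<close> exchanges the images of the two ends that the rotation sends to the ends
  of \<open>e\<close>.\<close>

lemma num_faces_insert_edge:
  assumes F: "F \<subseteq> edges D" and e: "e \<in> edges D" "e \<notin> F"
  shows "num_faces (restrict_edges D F) = Suc (num_faces (restrict_edges D (insert e F))) \<or>
    num_faces (restrict_edges D (insert e F)) = Suc (num_faces (restrict_edges D F))"
proof -
  have ne: "edges D \<noteq> {}"
    using e by auto
  have "rot D ` ends D = ends D"
    using rot_bij by (rule bij_betw_imp_surj_on)
  moreover have "(e, False) \<in> ends D" "(e, True) \<in> ends D"
    using e by simp_all
  ultimately obtain a b where ab: "a \<in> ends D" "b \<in> ends D" "rot D a = (e, False)" "rot D b = (e, True)"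
    by (metis (no_types, lifting) imageE)
  have inj: "inj_on (rot D) (ends D)"
    using rot_bij by (rule bij_betw_imp_inj_on)
  let ?p = "\<lambda>F x. flip_in F (rot D x)"
  have "inj_on (flip_in F) A" for A
    by (rule inj_on_inverseI[of _ "flip_in F"]) simp
  then have "inj_on (?p F) (ends D)"
    using comp_inj_on[OF inj, of "flip_in F"] by (simp add: comp_def)
  moreover have "?p (insert e F) x = ?p F x" if "x \<in> ends D" "x \<noteq> a" "x \<noteq> b" for x
  proof -
    have "rot D x \<noteq> (e, False)" "rot D x \<noteq> (e, True)"
      using that ab inj by (metis inj_onD)+
    then have "fst (rot D x) \<noteq> e"
      by (cases "rot D x"; cases "snd (rot D x)") auto
    then show ?thesis
      by (simp add: flip_in_def)
  qed
  moreover have "?p F ` ends D \<subseteq> ends D"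
    using rot_in_ends by auto
  moreover have "a \<noteq> b"
    using ab by auto
  ultimately show ?thesis
    unfolding num_faces_restrict_edges[OF F ne]
      num_faces_restrict_edges[OF insert_subsetI[OF e(1) F] ne]
    using ab e(2) by (intro card_cycles_swap[OF finite_ends, of _ a b]) (auto simp: flip_in_def)
qed

text \<open>A step that adds a face keeps \<open>g\<close>, and a step that removes one raises it; so \<open>g\<close> stays a natural
  number.\<close>

lemma faces_edges_parity:
  assumes "F \<subseteq> edges D"
  shows "\<exists>g. num_faces (restrict_edges D F) + 2 * g = Suc (card F)"
proof -
  have "finite F"
    using assms finite_edges by (rule finite_subset)
  then show ?thesis
    using assms
  proof (induction F rule: finite_induct)
    case empty
    then show ?case
      using one_vert by (simp add: num_faces_def ends_def num_verts_def classes_def)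
  next
    case (insert e F)
    then obtain g where g: "num_faces (restrict_edges D F) + 2 * g = Suc (card F)"
      by auto
    have "num_faces (restrict_edges D F) = Suc (num_faces (restrict_edges D (insert e F))) \<or>
        num_faces (restrict_edges D (insert e F)) = Suc (num_faces (restrict_edges D F))"
      using insert by (intro num_faces_insert_edge) auto
    then show ?case
      using g insert by (auto intro: exI[of _ g] exI[of _ "Suc g"])
  qed
qed

lemma genus_restrict_edges:
  assumes "F \<subseteq> edges D"
  shows "0 \<le> genus (restrict_edges D F)"
    and "int (num_faces (restrict_edges D F)) = 1 + int (card F) - 2 * genus (restrict_edges D F)"
proof -
  obtain v where "verts D = {v}"
    using obtain_vertex by blast
  then have "num_comps (restrict_edges D F) = 1" "num_verts (restrict_edges D F) = 1"
    by (simp_all add: num_comps_def num_verts_def classes_def)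
  moreover obtain g where "num_faces (restrict_edges D F) + 2 * g = Suc (card F)"
    using faces_edges_parity[OF assms] by blast
  ultimately have "genus (restrict_edges D F) = int g"
      "int (num_faces (restrict_edges D F)) = 1 + int (card F) - 2 * int g"
    unfolding genus_def num_edges_def edges_restrict_edges by linarith+
  then show "0 \<le> genus (restrict_edges D F)"
    and "int (num_faces (restrict_edges D F)) = 1 + int (card F) - 2 * genus (restrict_edges D F)"
    by simp_all
qed

end


section \<open>The two sides of a single state circle\<close>

lemma half_edges_iff [simp]: "(c, i) \<in> half_edges P \<longleftrightarrow> c < crossings P \<and> i < 4"
  by (auto simp: half_edges_def)

lemma finite_half_edges: "finite (half_edges P)"
  by (simp add: half_edges_def)

lemma right_corner_in: "h \<in> half_edges P \<Longrightarrow> right_corner h \<in> half_edges P"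
  by (cases h) simp

lemma less_4_cases:
  fixes i :: nat
  assumes "i < 4"
  obtains "i = 0" | "i = 1" | "i = 2" | "i = 3"
  using assms by linarith

lemma splice_steps_cases:
  assumes "(u, v) \<in> splice_steps P s"
  obtains "u \<in> half_edges P" "v = join P u"
  | c i where "u = (c, i)" "v = (c, spliced_to (s c) i)" "c < crossings P" "i < 4"
  using assms unfolding splice_steps_def by auto

locale one_circle_projection =
  fixes P :: projection
  assumes link: "link_projection P" and connected: "connected_projection P"
    and one_circle: "card (A_circles P) = 1"
begin

lemma join_in: "h \<in> half_edges P \<Longrightarrow> join P h \<in> half_edges P"
  and join_join: "h \<in> half_edges P \<Longrightarrow> join P (join P h) = h"
  using link by (auto simp: link_projection_def)

lemma crossings_pos: "0 < crossings P"
proof (rule ccontr)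
  assume "\<not> 0 < crossings P"
  then have "half_edges P = {}"
    by (simp add: half_edges_def)
  then show False
    using one_circle by (simp add: circles_def classes_def)
qed

lemma splice_steps_subset: "splice_steps P s \<subseteq> half_edges P \<times> half_edges P"
proof -
  have "spliced_to x i < 4" if "i < 4" for x i
    using that by (cases x) (auto elim!: less_4_cases)
  then show ?thesis
    unfolding splice_steps_def using join_in by auto
qed

lemma A_circle_of_eq: "h \<in> half_edges P \<Longrightarrow> A_circle_of P h = half_edges P"
  using classes_eq_singleton[OF splice_steps_subset, of "\<lambda>_. SplA"] one_circle
  by (auto simp: A_circle_of_def circles_def classes_def)

lemma A_circles_eq: "A_circles P = {half_edges P}"
  using classes_eq_singleton[OF splice_steps_subset, of "\<lambda>_. SplA"] one_circle
  by (simp add: circles_def)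

text \<open>The side of the circle on which a corner lies. For a half-edge \<open>h\<close>, travelling outwards, the
  side to the left is \<open>side h\<close> and the side to the right is \<open>side (right_corner h)\<close>.\<close>

definition side :: "nat \<times> nat \<Rightarrow> (nat \<times> nat) set" where
  "side h = class_of (moves_avoiding P (half_edges P)) h"

lemma moves_avoiding_eq:
  "moves_avoiding P (half_edges P) = region_steps P \<union> (\<lambda>c. ((c, 1), (c, 3))) ` {..<crossings P}"
  by (auto simp: moves_avoiding_def)

text \<open>There is no circle other than \<open>half_edges P\<close>, so its depth is zero and it is oriented with its
  inside on the left.\<close>

lemma forward_iff: "h \<in> half_edges P \<Longrightarrow> forward P h \<longleftrightarrow> side (outer P) \<noteq> side h"
proof -
  assume h: "h \<in> half_edges P"
  have "{\<delta> \<in> A_circles P. \<delta> \<noteq> half_edges P \<and> (\<forall>h \<in> half_edges P. inside P \<delta> h)} = {}"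
    using A_circles_eq by blast
  then have "depth P (half_edges P) = 0"
    by (simp only: depth_def card.empty)
  then show ?thesis
    using h by (simp add: forward_def A_circle_of_eq inside_def side_def mem_class_of_iff)
qed

lemma side_right_corner_join:
  assumes "h \<in> half_edges P"
  shows "side (right_corner (join P h)) = side h"
proof -
  have "(h, right_corner (join P h)) \<in> moves_avoiding P (half_edges P)"
    using assms unfolding moves_avoiding_def region_steps_def by blast
  then show ?thesis
    unfolding side_def by (rule class_of_step[symmetric])
qed

lemma side_channel: "c < crossings P \<Longrightarrow> side (c, 3) = side (c, 1)"
  unfolding side_def by (rule class_of_step[symmetric]) (auto simp: moves_avoiding_def)

lemma graph_comps_eq: "graph_comps P = 1" and loops_eq: "loops P = 0"
proof -
  have "classes {..<crossings P} {(fst h, fst (join P h)) | h. h \<in> half_edges P} \<noteq> {}"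
    using crossings_pos by (auto simp: classes_def)
  then have "graph_comps P \<noteq> 0"
    by (simp add: graph_comps_def classes_def)
  then show "graph_comps P = 1" "loops P = 0"
    using connected by (simp_all add: connected_projection_def)
qed

text \<open>By Euler's formula there are \<open>n + 2\<close> regions, and the \<open>n\<close> channels merge at most \<open>n\<close> pairs of
  them.\<close>

lemma two_sides: "2 \<le> card (side ` half_edges P)"
proof -
  let ?s = "(\<lambda>c. ((c, 1), (c, 3))) ` {..<crossings P} :: ((nat \<times> nat) \<times> (nat \<times> nat)) set"
  have "num_regions P = crossings P + 2"
    using link by (simp add: link_projection_def graph_comps_eq)
  moreover have "num_regions P \<le> card (classes (half_edges P) (moves_avoiding P (half_edges P))) + card ?s"
    unfolding num_regions_def moves_avoiding_eq
    by (rule card_classes_Un_le) (auto simp: finite_half_edges)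
  moreover have "card ?s \<le> crossings P"
    using card_image_le[of "{..<crossings P}" "\<lambda>c. ((c, 1::nat), (c, 3::nat))"] by simp
  ultimately show ?thesis
    by (simp add: classes_def side_def[abs_def])
qed

text \<open>Along an arc, and through an \<open>A\<close>-splicing because of the channel across it, a walk along the
  circle keeps its left and its right side. Reading off the sides at the far half-edge reverses the
  direction of travel, so only the unordered pair is an invariant.\<close>

lemma sides_of_half_edge:
  assumes h: "h \<in> half_edges P" and h': "h' \<in> half_edges P"
  shows "{side h, side (right_corner h)} = {side h', side (right_corner h')}"
proof -
  have "class_of (splice_steps P (\<lambda>_. SplA)) h = class_of (splice_steps P (\<lambda>_. SplA)) h'"
    using A_circle_of_eq[OF h] A_circle_of_eq[OF h'] by (simp add: A_circle_of_def)
  then show ?thesis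
  proof (rule class_of_invariant)
    fix u v assume "(u, v) \<in> splice_steps P (\<lambda>_. SplA)"
    then show "{side u, side (right_corner u)} = {side v, side (right_corner v)}"
    proof (cases rule: splice_steps_cases)
      case 1
      then show ?thesis
        using side_right_corner_join[OF 1(1)] side_right_corner_join[OF join_in[OF 1(1)]]
        by (simp add: join_join insert_commute)
    next
      case 2
      from 2(4) show ?thesis
        by (cases rule: less_4_cases) (simp_all add: 2 side_channel insert_commute)
    qed
  qed
qed

lemma sides_differ:
  assumes "h \<in> half_edges P"
  shows "side h \<noteq> side (right_corner h)"
proof
  assume "side h = side (right_corner h)"
  then have "side ` half_edges P \<subseteq> {side h}"
    using sides_of_half_edge[OF _ assms] by (simp add: doubleton_eq_iff image_subset_iff)
  then have "card (side ` half_edges P) \<le> 1"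
    using card_mono[of "{side h}"] by fastforce
  then show False
    using two_sides by simp
qed

text \<open>The two sides of \<open>h\<close> are different and one of them is the unbounded one.\<close>

lemma forward_right_corner:
  assumes "h \<in> half_edges P"
  shows "forward P (right_corner h) \<longleftrightarrow> \<not> forward P h"
proof -
  have "outer P \<in> half_edges P"
    using link crossings_pos by (simp add: link_projection_def)
  then have "side (outer P) \<in> {side h, side (right_corner h)}"
    using sides_of_half_edge[OF _ assms, of "outer P"] by blast
  then show ?thesis
    using sides_differ[OF assms] assms
    by (auto simp: forward_iff right_corner_in)
qed

lemma forward_join:
  assumes "h \<in> half_edges P"
  shows "forward P (join P h) \<longleftrightarrow> \<not> forward P h"
  using forward_right_corner[OF join_in[OF assms]] side_right_corner_join[OF assms] assms
  by (simp add: forward_iff right_corner_in join_in)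

lemma forward_at_crossing:
  assumes "c < crossings P" "i < 4"
  shows "forward P (c, i) \<longleftrightarrow> (even i \<longleftrightarrow> forward P (c, 0))"
proof -
  have "forward P (c, j) \<longleftrightarrow> \<not> forward P (c, Suc j)" if "j < 3" for j
    using forward_right_corner[of "(c, Suc j)"] assms that by simp
  from this[of 0] this[of 1] this[of 2]
  have "forward P (c, 1) \<longleftrightarrow> \<not> forward P (c, 0)" "forward P (c, 2) \<longleftrightarrow> forward P (c, 0)"
    "forward P (c, 3) \<longleftrightarrow> \<not> forward P (c, 0)"
    by (simp_all add: numeral_2_eq_2 numeral_3_eq_3)
  with assms(2) show ?thesis
    by (cases rule: less_4_cases) simp_all
qed


section \<open>State circles as cycles of arc-ends\<close>

text \<open>The half-edges through which the oriented circle leaves, respectively reaches, the arc-end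
  \<open>x\<close>. Since forward half-edges alternate around a crossing, the direction of the half-edge 0 decides
  for both strands.\<close>

definition out_at :: "nat \<times> bool \<Rightarrow> nat \<times> nat" where
  "out_at x = (fst x, (if snd x then 2 else 0) + (if forward P (fst x, 0) then 0 else 1))"

definition in_at :: "nat \<times> bool \<Rightarrow> nat \<times> nat" where
  "in_at x = (fst x, (if snd x then 2 else 0) + (if forward P (fst x, 0) then 1 else 0))"

lemma edges_all_A: "edges (all_A_dessin P) = {..<crossings P}"
  and rot_all_A: "rot (all_A_dessin P) = next_end P"
  by (simp_all add: all_A_dessin_def)

lemma out_at_props:
  assumes "fst x < crossings P"
  shows "out_at x \<in> half_edges P" "forward P (out_at x)" "end_at (out_at x) = x"
  using assms forward_at_crossing[OF assms, of 1] forward_at_crossing[OF assms, of 2]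
    forward_at_crossing[OF assms, of 3]
  by (cases x; auto simp: out_at_def numeral_3_eq_3[symmetric])+

lemma end_at_in_at [simp]: "end_at (in_at x) = x"
  by (cases x) (simp add: in_at_def)

lemma end_at_in: "h \<in> half_edges P \<Longrightarrow> fst (end_at h) < crossings P"
  by (cases h) simp

lemma half_edge_cases:
  assumes "h \<in> half_edges P"
  shows "h = (if forward P h then out_at (end_at h) else in_at (end_at h))"
proof -
  obtain c i where h: "h = (c, i)" "c < crossings P" "i < 4"
    using assms by (cases h) simp
  from h(3) show ?thesis
    using forward_at_crossing[OF h(2,3)]
    by (cases rule: less_4_cases) (auto simp: h(1) out_at_def in_at_def)
qed

lemma join_out_at:
  assumes x: "fst x < crossings P"
  shows "join P (out_at x) = in_at (next_end P x)" and "fst (next_end P x) < crossings P"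
proof -
  have "(THE h. h \<in> half_edges P \<and> end_at h = x \<and> forward P h) = out_at x"
  proof (rule the_equality)
    fix h assume "h \<in> half_edges P \<and> end_at h = x \<and> forward P h"
    then show "h = out_at x"
      using half_edge_cases[of h] by simp
  qed (use out_at_props[OF x] in simp)
  then have next_end: "next_end P x = end_at (join P (out_at x))"
    by (simp add: next_end_def)
  have "\<not> forward P (join P (out_at x))"
    using forward_join out_at_props[OF x] by simp
  then show "join P (out_at x) = in_at (next_end P x)"
    using half_edge_cases[OF join_in[OF out_at_props(1)[OF x]]] by (simp add: next_end)
  show "fst (next_end P x) < crossings P"
    using next_end end_at_in join_in out_at_props(1)[OF x] by simp
qed

abbreviation state :: "nat set \<Rightarrow> nat \<Rightarrow> splicing" where
  "state F \<equiv> \<lambda>c. if c \<in> F then SplB else SplA"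

text \<open>The arc-end from which a traveller at the half-edge \<open>h\<close> sets out: on an outgoing half-edge it is
  the end at \<open>h\<close>, and on an incoming one it is where the splicing leads.\<close>

definition exit_end :: "nat set \<Rightarrow> nat \<times> nat \<Rightarrow> nat \<times> bool" where
  "exit_end F h = (if forward P h then end_at h else flip_in F (end_at h))"

text \<open>Both splicings connect incoming with outgoing half-edges, the \<open>A\<close>-splicing at the same arc-end
  and the \<open>B\<close>-splicing at the opposite one.\<close>

lemma splice_in_at:
  assumes "fst x < crossings P"
  shows "(in_at x, out_at (flip_in F x)) \<in> splice_steps P (state F)"
proof -
  obtain c b where x: "x = (c, b)"
    by (cases x)
  have "out_at (flip_in F x) = (c, spliced_to (state F c) (snd (in_at x)))"
    by (simp add: x in_at_def out_at_def flip_in_def)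
  moreover have "in_at x = (c, snd (in_at x))" "snd (in_at x) < 4"
    by (simp_all add: x in_at_def)
  ultimately show ?thesis
    using assms x unfolding splice_steps_def by auto
qed

lemma exit_end_splice:
  assumes c: "c < crossings P" and i: "i < 4"
  shows "exit_end F (c, spliced_to (state F c) i) = exit_end F (c, i)"
proof -
  have fwd: "forward P (c, j) \<longleftrightarrow> (even j \<longleftrightarrow> forward P (c, 0))" if "j < 4" for j
    using forward_at_crossing[OF c that] .
  from i show ?thesis
    using fwd[of 1] fwd[of 2] fwd[of 3] fwd[of "Suc (Suc 0)"]
    by (cases rule: less_4_cases) (simp_all add: exit_end_def flip_in_def)
qed

text \<open>All states inherit the orientation of the all-\<open>A\<close> circle, so following a state circle
  permutes the outgoing half-edges, of which there is one for each arc-end.\<close>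

lemma card_circles_eq_cycles:
  "card (circles P (state F)) =
    card (classes (ends (all_A_dessin P)) (graph_on (ends (all_A_dessin P)) (\<lambda>x. flip_in F (next_end P x))))"
  (is "_ = card (classes ?E ?cycles)")
  unfolding circles_def
proof (rule sym, rule card_classes_transfer[where f = out_at and g = "exit_end F"])
  let ?K = "class_of (splice_steps P (state F))"
  have enter: "?K (in_at x) = ?K (out_at (flip_in F x))" if "fst x < crossings P" for x
    using splice_in_at[OF that] by (rule class_of_step)
  have mem: "x \<in> ?E \<longleftrightarrow> fst x < crossings P" for x
    by (simp add: edges_all_A)
  show "out_at x \<in> half_edges P" if "x \<in> ?E" for x
    using that unfolding mem by (rule out_at_props(1))
  show "exit_end F h \<in> ?E" if "h \<in> half_edges P" for h
    using end_at_in[OF that] by (simp add: mem exit_end_def del: mem_ends)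
  show "?K (out_at x) = ?K (out_at x')" if "(x, x') \<in> ?cycles" for x x'
  proof -
    have x: "fst x < crossings P" and x': "x' = flip_in F (next_end P x)"
      using that mem by blast+
    have "(out_at x, join P (out_at x)) \<in> splice_steps P (state F)"
      using out_at_props(1)[OF x] unfolding splice_steps_def by blast
    then have "?K (out_at x) = ?K (join P (out_at x))"
      by (rule class_of_step)
    then show ?thesis
      using enter[OF join_out_at(2)[OF x]] by (simp add: join_out_at(1)[OF x] x')
  qed
  \<comment> \<open>it suffices to traverse an arc along its orientation: the opposite step of the generating
    relation is the same equation read from right to left\<close>
  have cycle_step: "class_of ?cycles (exit_end F h) = class_of ?cycles (exit_end F (join P h))"
    if h: "h \<in> half_edges P" "forward P h" for h
  proof -
    have x: "fst (end_at h) < crossings P"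
      using end_at_in[OF h(1)] .
    have "h = out_at (end_at h)"
      using half_edge_cases[OF h(1)] h(2) by simp
    then have "end_at (join P h) = next_end P (end_at h)"
      using join_out_at(1)[OF x] by simp
    then have "exit_end F (join P h) = flip_in F (next_end P (end_at h))"
      using forward_join[OF h(1)] h(2) by (simp add: exit_end_def)
    moreover have "exit_end F h = end_at h"
      using h(2) by (simp add: exit_end_def)
    ultimately show ?thesis
      using class_of_graph_step[of "end_at h" ?E] x by (simp add: mem del: mem_ends)
  qed
  show "class_of ?cycles (exit_end F u) = class_of ?cycles (exit_end F v)"
    if "(u, v) \<in> splice_steps P (state F)" for u v
    using that
  proof (cases rule: splice_steps_cases)
    case 1
    then show ?thesis
      using cycle_step[of u] cycle_step[of v] by (cases "forward P u") (simp_all add: join_in join_join forward_join)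
  next
    case (2 c i)
    then show ?thesis
      using exit_end_splice[of c i F] by simp
  qed
  show "class_of ?cycles (exit_end F (out_at x)) = class_of ?cycles x" if "x \<in> ?E" for x
    using out_at_props[of x] that by (simp add: mem exit_end_def del: mem_ends)
  show "?K (out_at (exit_end F h)) = ?K h" if "h \<in> half_edges P" for h
    using half_edge_cases[OF that] enter[OF end_at_in[OF that]] by (auto simp: exit_end_def split: if_splits)
qed

text \<open>For \<open>F = {}\<close> the count of state circles says that \<open>next_end P\<close> has a single cycle, as the
  well-formedness of a one-vertex dessin demands.\<close>

lemma one_vertex_all_A: "one_vertex_dessin (all_A_dessin P)"
proof
  let ?D = "all_A_dessin P"
  have E: "x \<in> ends ?D \<longleftrightarrow> fst x < crossings P" for x
    by (simp add: edges_all_A)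
  have verts: "verts ?D = {Inl (half_edges P)}"
    by (simp add: all_A_dessin_def loops_eq A_circles_eq Plus_def)
  then show "num_verts ?D = 1"
    by (simp add: num_verts_def)
  have incid: "incid ?D x = Inl (half_edges P)" if "x \<in> ends ?D" for x
    using that by (cases x) (simp add: all_A_dessin_def A_circle_of_eq)
  have fin: "finite (ends ?D)"
    by (simp add: ends_def edges_all_A)
  have "inj_on (next_end P) (ends ?D)"
  proof (rule inj_onI)
    fix x y assume "x \<in> ends ?D" "y \<in> ends ?D" and eq: "next_end P x = next_end P y"
    then have x: "fst x < crossings P" and y: "fst y < crossings P"
      by (simp_all only: E)
    have "join P (out_at x) = join P (out_at y)"
      using eq by (simp add: join_out_at(1) x y)
    then have "out_at x = out_at y"
      using join_join out_at_props(1) x y by metis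
    then show "x = y"
      using out_at_props(3) x y by metis
  qed
  moreover have "next_end P ` ends ?D \<subseteq> ends ?D"
    using join_out_at(2) by (simp add: image_subset_iff E del: mem_ends)
  ultimately have bij: "bij_betw (next_end P) (ends ?D) (ends ?D)"
    unfolding bij_betw_def using endo_inj_surj[OF fin] by blast
  have "card (classes (ends ?D) (graph_on (ends ?D) (next_end P))) = 1"
    using card_circles_eq_cycles[of "{}"] one_circle by (simp add: flip_in_def)
  then have "classes (ends ?D) (graph_on (ends ?D) (next_end P)) = {ends ?D}"
    using bij_betwE[OF bij] by (intro classes_eq_singleton) blast+
  moreover have "(0, False) \<in> ends ?D"
    using crossings_pos by (simp add: E del: mem_ends)
  then have "incid ?D ` ends ?D = {Inl (half_edges P)}"
    using image_cong[OF refl incid, of "ends ?D" id] by (simp only: id_apply image_constant)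
  moreover have "{x \<in> ends ?D. incid ?D x = Inl (half_edges P)} = ends ?D"
    using incid by blast
  ultimately show "wf_dessin ?D"
    unfolding wf_dessin_def rot_all_A
    using bij verts
    by (simp only: setcompr_eq_image Collect_mem_eq image_insert image_empty) (simp add: edges_all_A)
qed

lemma num_circles_eq_num_faces:
  assumes "F \<subseteq> {..<crossings P}"
  shows "num_circles P (state F) = num_faces (restrict_edges (all_A_dessin P) F)"
proof -
  interpret one_vertex_dessin "all_A_dessin P"
    by (rule one_vertex_all_A)
  have "F \<subseteq> edges (all_A_dessin P)" "edges (all_A_dessin P) \<noteq> {}"
    using assms crossings_pos by (auto simp: edges_all_A)
  note num_faces_restrict_edges[OF this]
  then show ?thesis
    using card_circles_eq_cycles[of F]
    by (simp only: num_circles_def loops_eq rot_all_A add_0_right)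
qed

end


text \<open>The one vertex is either a state circle or a crossingless component. In the second case there
  are no crossings, and the only sub-dessin is an isolated vertex with one face.\<close>

lemma all_A_dessin_one_vertex:
  assumes "link_projection P" "connected_projection P" "num_verts (all_A_dessin P) = 1"
  shows "one_vertex_dessin (all_A_dessin P)"
    and "F \<subseteq> {..<crossings P} \<Longrightarrow>
      num_circles P (\<lambda>c. if c \<in> F then SplB else SplA) = num_faces (restrict_edges (all_A_dessin P) F)"
proof -
  let ?D = "all_A_dessin P"
  have "finite (A_circles P)"
    by (simp add: circles_def classes_def finite_half_edges)
  then have verts: "card (A_circles P) + loops P = 1"
    using assms(3) by (simp add: num_verts_def all_A_dessin_def card_Plus)
  have "one_vertex_dessin ?D \<and> (F \<subseteq> {..<crossings P} \<longrightarrow>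
      num_circles P (\<lambda>c. if c \<in> F then SplB else SplA) = num_faces (restrict_edges ?D F))"
  proof (cases "crossings P = 0")
    case True
    have no_half_edges: "half_edges P = {}"
      using True by (simp add: half_edges_def)
    then have "circles P s = {}" for s
      by (simp add: circles_def classes_def)
    then have "num_circles P s = 1" for s
      using verts by (simp add: num_circles_def)
    moreover have ends: "ends ?D = {}" "edges ?D = {}"
      using True by (simp_all add: ends_def all_A_dessin_def)
    have "finite (verts ?D)"
      using assms(3) card.infinite by (fastforce simp: num_verts_def)
    then have "wf_dessin ?D"
      using ends by (simp add: wf_dessin_def classes_def bij_betw_def)
    moreover have "num_faces (restrict_edges ?D {}) = 1"
      using assms(3) by (simp add: num_faces_def ends_def num_verts_def classes_def)
    ultimately show ?thesis
      using assms(3) True by (simp add: one_vertex_dessin_def)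
  next
    case False
    have "circles P (\<lambda>_. SplA) \<noteq> {}"
      using False by (auto simp: circles_def classes_def half_edges_def lessThan_empty_iff)
    then have "card (A_circles P) \<noteq> 0"
      using \<open>finite (A_circles P)\<close> by simp
    then have "card (A_circles P) = 1"
      using verts by linarith
    then interpret one_circle_projection P
      using assms by unfold_locales
    show ?thesis
      using one_vertex_all_A num_circles_eq_num_faces by blast
  qed
  then show "one_vertex_dessin ?D"
    and "F \<subseteq> {..<crossings P} \<Longrightarrow>
      num_circles P (\<lambda>c. if c \<in> F then SplB else SplA) = num_faces (restrict_edges ?D F)"
    by blast+
qed


section \<open>Coefficients of the bracket\<close>

lemma bracket_rec_state_sum:
  assumes "distinct cs"
  shows "bracket_rec P cs s = (\<Sum>F\<in>Pow (set cs). A_pow (int (length cs) - 2 * int (card F)) *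
    (- A_pow 2 - A_pow (- 2)) ^
      (num_circles P (\<lambda>c. if c \<in> set cs then if c \<in> F then SplB else SplA else s c) - 1))"
  using assms
proof (induction cs arbitrary: s)
  case Nil
  then show ?case
    by (simp add: A_pow_def)
next
  case (Cons a cs)
  let ?d = "- A_pow 2 - A_pow (- 2)"
  let ?n = "\<lambda>cs F s. num_circles P (\<lambda>c. if c \<in> set cs then if c \<in> F then SplB else SplA else s c) - 1"
  let ?t = "\<lambda>F. A_pow (int (length (a # cs)) - 2 * int (card F)) * ?d ^ ?n (a # cs) F s"
  have mult: "A_pow i * A_pow j = A_pow (i + j)" for i j
    by (simp add: A_pow_def mult_single)
  have a: "a \<notin> set cs"
    using Cons.prems by simp
  have notin: "a \<notin> F" if "F \<in> Pow (set cs)" for F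
    using that a by blast
  have A: "A_pow 1 * bracket_rec P cs (s(a := SplA)) = (\<Sum>F\<in>Pow (set cs). ?t F)"
    using Cons
  proof (simp only: Cons.IH distinct.simps sum_distrib_left mult.assoc[symmetric] mult, intro sum.cong refl)
    fix F assume "F \<in> Pow (set cs)"
    then have "(\<lambda>c. if c \<in> set cs then if c \<in> F then SplB else SplA else (s(a := SplA)) c) =
        (\<lambda>c. if c \<in> set (a # cs) then if c \<in> F then SplB else SplA else s c)"
      using a notin by fastforce
    then show "A_pow (1 + (int (length cs) - 2 * int (card F))) * ?d ^ ?n cs F (s(a := SplA)) = ?t F"
      by (simp add: algebra_simps)
  qed
  have B: "A_pow (- 1) * bracket_rec P cs (s(a := SplB)) = (\<Sum>F\<in>Pow (set cs). ?t (insert a F))"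
    using Cons
  proof (simp only: Cons.IH distinct.simps sum_distrib_left mult.assoc[symmetric] mult, intro sum.cong refl)
    fix F assume F: "F \<in> Pow (set cs)"
    then have "(\<lambda>c. if c \<in> set cs then if c \<in> F then SplB else SplA else (s(a := SplB)) c) =
        (\<lambda>c. if c \<in> set (a # cs) then if c \<in> insert a F then SplB else SplA else s c)"
      using a by fastforce
    moreover have "card (insert a F) = Suc (card F)"
      using F notin by (meson PowD card_insert_disjoint finite_set finite_subset)
    ultimately show "A_pow (- 1 + (int (length cs) - 2 * int (card F))) * ?d ^ ?n cs F (s(a := SplB)) =
        ?t (insert a F)"
      by (simp add: algebra_simps)
  qed
  have "inj_on (insert a) (Pow (set cs))"
    by (rule inj_onI) (use notin insert_ident in metis)
  moreover have "Pow (set cs) \<inter> insert a ` Pow (set cs) = {}"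
    using a by blast
  ultimately have "(\<Sum>F\<in>Pow (set (a # cs)). ?t F) =
      (\<Sum>F\<in>Pow (set cs). ?t F) + (\<Sum>F\<in>Pow (set cs). ?t (insert a F))"
    unfolding list.set Pow_insert by (subst sum.union_disjoint) (simp_all add: sum.reindex)
  then show ?case
    unfolding bracket_rec.simps A B by (rule sym)
qed

lemma of_int_eq_single: "of_int a = (Poly_Mapping.single 0 a :: laurent)"
  by (induction a rule: int_induct[of _ 0]) (simp_all add: single_add single_diff)

text \<open>Consecutive terms of the binomial expansion differ by the factor \<open>A ^ (-4)\<close>. The index \<open>j\<close> is an
  integer because \<open>l - g(H)\<close> is negative for sub-dessins of large genus.\<close>

lemma lookup_A_pow_times_loops:
  "Poly_Mapping.lookup (A_pow k * (- A_pow 2 - A_pow (- 2)) ^ m) (k + 2 * int m - 4 * j) =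
    (if 0 \<le> j then (- 1) ^ m * int (m choose nat j) else 0)"
proof -
  have mult: "A_pow i * A_pow j = A_pow (i + j)" for i j
    by (simp add: A_pow_def mult_single)
  have pow: "A_pow i ^ r = A_pow (int r * i)" for i r
    by (induction r) (simp_all add: mult algebra_simps, simp add: A_pow_def)
  have scale: "of_int a * A_pow i = Poly_Mapping.single i a" for a i
    by (simp add: A_pow_def of_int_eq_single mult_single)
  have "(- A_pow 2 - A_pow (- 2)) ^ m = (- 1) ^ m * (A_pow (- 2) + A_pow 2) ^ m"
  proof -
    have "- A_pow 2 - A_pow (- 2) = - (A_pow (- 2) + A_pow 2)"
      by simp
    then show ?thesis
      by (simp only: power_minus[of "A_pow (- 2) + A_pow 2"])
  qed
  also have "(A_pow (- 2) + A_pow 2) ^ m = (\<Sum>i\<le>m. of_nat (m choose i) * A_pow (2 * int m - 4 * int i))"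
    unfolding binomial_ring
    by (intro sum.cong refl) (simp add: pow mult mult.assoc of_nat_diff algebra_simps)
  finally have "A_pow k * (- A_pow 2 - A_pow (- 2)) ^ m =
      (\<Sum>i\<le>m. of_int ((- 1) ^ m * int (m choose i)) * A_pow (k + 2 * int m - 4 * int i))"
    by (simp add: sum_distrib_left mult[symmetric] mult.assoc mult.left_commute add_diff_eq[symmetric])
  then have "Poly_Mapping.lookup (A_pow k * (- A_pow 2 - A_pow (- 2)) ^ m) (k + 2 * int m - 4 * j) =
      (\<Sum>i\<le>m. if int i = j then (- 1) ^ m * int (m choose i) else 0)"
    unfolding scale by (simp add: lookup_sum lookup_single when_def)
  also have "\<dots> = (if 0 \<le> j then (- 1) ^ m * int (m choose nat j) else 0)"
  proof (cases "0 \<le> j")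
    case True
    then have "int i = j \<longleftrightarrow> i = nat j" for i
      by linarith
    then show ?thesis
      using True by (simp add: sum.delta')
  qed (auto intro!: sum.neutral)
  finally show ?thesis .
qed

theorem corollary6p4:
  fixes P :: projection
  assumes "link_projection P"
    and "connected_projection P"
    and "num_verts (all_A_dessin P) = 1"
  shows "(\<forall>l::nat. bracket_coeff P l =
            (\<Sum>H \<in> {H \<in> sub_dessins (all_A_dessin P). 0 \<le> genus H \<and> genus H \<le> int l}.
               (- 1) ^ num_edges H *
               int (nat (int (num_edges H) - 2 * genus H) choose nat (int l - genus H))))
       \<and> bracket_coeff P 0 =
            (\<Sum>H \<in> {H \<in> sub_dessins (all_A_dessin P). genus H = 0}. (- 1) ^ num_edges H)
       \<and> bracket_coeff P 1 =
            (\<Sum>H \<in> {H \<in> sub_dessins (all_A_dessin P). genus H = 1}. (- 1) ^ num_edges H)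
          + (\<Sum>H \<in> {H \<in> sub_dessins (all_A_dessin P). genus H = 0}.
               (- 1) ^ num_edges H * int (num_edges H))"
proof -
  let ?D = "all_A_dessin P"
  let ?S = "sub_dessins ?D"
  let ?t = "\<lambda>l H. (- 1) ^ num_edges H * int (nat (int (num_edges H) - 2 * genus H) choose nat (int l - genus H))"
  let ?d = "- A_pow 2 - A_pow (- 2)"
  interpret one_vertex_dessin ?D
    using assms by (rule all_A_dessin_one_vertex)
  have edges: "edges ?D = {..<crossings P}"
    by (simp add: all_A_dessin_def)
  have fin: "finite ?S"
    by (simp add: sub_dessins_def finite_edges)
  have genus_nonneg: "0 \<le> genus H" if "H \<in> ?S" for H
    using that genus_restrict_edges(1) by (auto simp: sub_dessins_def)
  have "inj_on (restrict_edges ?D) (Pow (edges ?D))"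
    by (rule inj_on_inverseI[of _ edges]) simp
  then have reindex: "(\<Sum>H\<in>?S. f H) = (\<Sum>F\<in>Pow {..<crossings P}. f (restrict_edges ?D F))"
    for f :: "_ \<Rightarrow> int"
    by (simp add: sub_dessins_def sum.reindex edges)
  have main: "bracket_coeff P l = (\<Sum>H\<in>{H \<in> ?S. 0 \<le> genus H \<and> genus H \<le> int l}. ?t l H)" for l
  proof -
    have exponent: "int (num_edges ?D) + 2 * int (num_verts ?D) - 2 - 4 * int l = int (crossings P) - 4 * int l"
      using assms(3) by (simp add: num_edges_def edges)
    let ?c = "\<lambda>F. Poly_Mapping.lookup (A_pow (int (crossings P) - 2 * int (card F)) *
        ?d ^ (num_circles P (\<lambda>c. if c < crossings P then if c \<in> F then SplB else SplA else SplA) - 1))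
        (int (crossings P) - 4 * int l)"
    have summand: "?c F = (if genus (restrict_edges ?D F) \<le> int l then ?t l (restrict_edges ?D F) else 0)"
      if F: "F \<subseteq> {..<crossings P}" for F
    proof -
      let ?H = "restrict_edges ?D F"
      have "(\<lambda>c. if c < crossings P then if c \<in> F then SplB else SplA else SplA) =
          (\<lambda>c. if c \<in> F then SplB else SplA)"
        using F by (intro ext) auto
      then have circles: "num_circles P (\<lambda>c. if c < crossings P then if c \<in> F then SplB else SplA else SplA) =
          num_faces ?H"
        using all_A_dessin_one_vertex(2)[OF assms F] by simp
      define m where "m = num_faces ?H - 1"
      have "0 < num_faces ?H"
        using F by (intro num_faces_pos) (simp add: edges)
      then have m: "int m = int (card F) - 2 * genus ?H"
        using genus_restrict_edges(2)[of F] F by (simp add: m_def edges)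
      \<comment> \<open>\<open>m\<close> and \<open>e(H)\<close> differ by an even number, so the sign of the loop factor is that of the
        theorem\<close>
      have "int (card F) = int m + 2 * int (nat (genus ?H))"
        using m genus_restrict_edges(1)[of F] F by (simp add: edges)
      then have "card F = m + 2 * nat (genus ?H)"
        by linarith
      then have sign: "(- 1 :: int) ^ m = (- 1) ^ card F"
        by (simp add: power_add)
      have exponent: "int (crossings P) - 2 * int (card F) + 2 * int m - 4 * (int l - genus ?H) =
          int (crossings P) - 4 * int l"
        unfolding m by simp
      have edges_H: "num_edges ?H = card F" "nat (int (card F) - 2 * genus ?H) = m"
        using m by (simp_all add: num_edges_def)
      show ?thesis
        using lookup_A_pow_times_loops[of "int (crossings P) - 2 * int (card F)" m "int l - genus ?H"]
        unfolding circles m_def[symmetric] exponent sign edges_H by simp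
    qed
    have "bracket_coeff P l = (\<Sum>F\<in>Pow {..<crossings P}. ?c F)"
      unfolding bracket_coeff_def exponent kauffman_bracket_def
      by (subst bracket_rec_state_sum) (simp_all add: lookup_sum atLeast0LessThan)
    also have "\<dots> = (\<Sum>F\<in>Pow {..<crossings P}.
        if genus (restrict_edges ?D F) \<le> int l then ?t l (restrict_edges ?D F) else 0)"
      by (intro sum.cong refl summand) simp
    also have "\<dots> = (\<Sum>H\<in>?S. if genus H \<le> int l then ?t l H else 0)"
      by (rule reindex[symmetric])
    also have "\<dots> = (\<Sum>H\<in>{H \<in> ?S. 0 \<le> genus H \<and> genus H \<le> int l}. ?t l H)"
      using fin genus_nonneg by (intro sum.mono_neutral_cong_right) auto
    finally show ?thesis .
  qed
  have "bracket_coeff P 0 = (\<Sum>H\<in>{H \<in> ?S. genus H = 0}. (- 1) ^ num_edges H)"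
    unfolding main by (intro sum.cong) auto
  moreover have "bracket_coeff P 1 = (\<Sum>H\<in>{H \<in> ?S. genus H = 1}. (- 1) ^ num_edges H) +
      (\<Sum>H\<in>{H \<in> ?S. genus H = 0}. (- 1) ^ num_edges H * int (num_edges H))"
  proof -
    have split: "{H \<in> ?S. 0 \<le> genus H \<and> genus H \<le> int 1} =
        {H \<in> ?S. genus H = 1} \<union> {H \<in> ?S. genus H = 0}"
      by auto
    have "bracket_coeff P 1 = (\<Sum>H\<in>{H \<in> ?S. genus H = 1}. ?t 1 H) + (\<Sum>H\<in>{H \<in> ?S. genus H = 0}. ?t 1 H)"
      unfolding main split using fin by (intro sum.union_disjoint) auto
    then show ?thesis
      by simp
  qed
  ultimately show ?thesis
    using main by blast
qed

end
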